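(* Let $\mathbf{k}$ be a field of characteristic $0$, let $(A,\mu,\alpha)$ be a Hom-algebra over $\mathbf{k}$, and let $\beta\colon A\to A$ be a morphism of Hom-algebras. Define the Hom-algebra $A_\beta=(A,\mu_\beta=\beta\mu,\beta\alpha)$. Then the following statements hold. (1) If $A$ is multiplicative, then so is $A_\beta$. (2) We have $(x^n)'=\beta^{n-1}(x^n)$ for all $x\in A$ and $n\ge 1$, where $x^n$ and $(x^n)'$ are the $n$th Hom-powers of $x$ in $A$ and $A_\beta$, respectively. (3) For each $n \geq 2$, if $A$ is $n$th Hom-power associative, then so is $A_\beta$. Therefore, if $A$ is Hom-power associative, then so is $A_\beta$.
   Context: A Hom-algebra $(A,\mu,\alpha)$ over $\mathbf{k}$ is a $\mathbf{k}$-vector space $A$ with a bilinear map $\mu\colon A^{\otimes 2}\to A$ (no associativity assumed) and a linear map $\alpha\colon A\to A$. It is multiplicative if $\alpha\mu=\mu\alpha^{\otimes 2}$. A morphism of Hom-algebras $f\colon A\to B$ is a linear map with $f\mu_A=\mu_B f^{\otimes 2}$ and $f\alpha_A=\alpha_B f$. Here $\alpha^n$ denotes the $n$-fold composition, $\alpha^0=Id$. The Hom-powers in a Hom-algebra $(A,\mu,\alpha)$ are: $x^1=x$ and $x^n=\mu(x^{n-1},\alpha^{n-2}(x))$ for $n\ge 2$. (In $A_\beta$ the same recursion is used with $\mu_\beta$ and $\beta\alpha$ in place of $\mu$ and $\alpha$.) A Hom-algebra is $n$th Hom-power associative if $x^n=\mu(\alpha^{n-i-1}(x^i),\alpha^{i-1}(x^{n-i}))$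 for all $x\in A$ and $i\in\{1,\dots,n-1\}$, and Hom-power associative if this holds for all $n\ge 2$. *)

theory Defs
  imports Complex_Main
begin

text \<open>A linear map out of \<open>A \<otimes> A\<close> is encoded as a curried function that is linear in each argument.\<close>

locale hom_algebra = vector_space s
  for s :: "'k::field \<Rightarrow> 'a::ab_group_add \<Rightarrow> 'a" +
  fixes \<mu> :: "'a \<Rightarrow> 'a \<Rightarrow> 'a"
    and \<alpha> :: "'a \<Rightarrow> 'a"
  assumes mult_linear_left: "\<And>y. Vector_Spaces.linear s s (\<lambda>x. \<mu> x y)"
    and mult_linear_right: "\<And>x. Vector_Spaces.linear s s (\<lambda>y. \<mu> x y)"
    and twist_linear: "Vector_Spaces.linear s s \<alpha>"

locale hom_algebra_morphism =
  A: hom_algebra sA \<mu>A \<alpha>A + B: hom_algebra sB \<mu>B \<alpha>B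
  for sA :: "'k::field \<Rightarrow> 'a::ab_group_add \<Rightarrow> 'a" and \<mu>A \<alpha>A
    and sB :: "'k \<Rightarrow> 'b::ab_group_add \<Rightarrow> 'b" and \<mu>B \<alpha>B +
  fixes f :: "'a \<Rightarrow> 'b"
  assumes linear: "Vector_Spaces.linear sA sB f"
    and map_mult: "\<And>x y. f (\<mu>A x y) = \<mu>B (f x) (f y)"
    and map_twist: "\<And>x. f (\<alpha>A x) = \<alpha>B (f x)"

definition multiplicative :: "('a \<Rightarrow> 'a \<Rightarrow> 'a) \<Rightarrow> ('a \<Rightarrow> 'a) \<Rightarrow> bool"
  where "multiplicative \<mu> \<alpha> \<longleftrightarrow> (\<forall>x y. \<alpha> (\<mu> x y) = \<mu> (\<alpha> x) (\<alpha> y))"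

text \<open>Hom-powers are only defined for positive exponents; the value at exponent 0 is unspecified.\<close>

fun hom_power :: "('a \<Rightarrow> 'a \<Rightarrow> 'a) \<Rightarrow> ('a \<Rightarrow> 'a) \<Rightarrow> 'a \<Rightarrow> nat \<Rightarrow> 'a"
  where
    "hom_power \<mu> \<alpha> x 0 = undefined"
  | "hom_power \<mu> \<alpha> x (Suc 0) = x"
  | "hom_power \<mu> \<alpha> x (Suc (Suc n)) = \<mu> (hom_power \<mu> \<alpha> x (Suc n)) ((\<alpha> ^^ n) x)"

definition nth_hom_power_associative :: "nat \<Rightarrow> ('a \<Rightarrow> 'a \<Rightarrow> 'a) \<Rightarrow> ('a \<Rightarrow> 'a) \<Rightarrow> bool"
  where "nth_hom_power_associative n \<mu> \<alpha> \<longleftrightarrow>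
    (\<forall>x. \<forall>i\<in>{1..n - 1}. hom_power \<mu> \<alpha> x n =
      \<mu> ((\<alpha> ^^ (n - i - 1)) (hom_power \<mu> \<alpha> x i)) ((\<alpha> ^^ (i - 1)) (hom_power \<mu> \<alpha> x (n - i))))"

definition hom_power_associative :: "('a \<Rightarrow> 'a \<Rightarrow> 'a) \<Rightarrow> ('a \<Rightarrow> 'a) \<Rightarrow> bool"
  where "hom_power_associative \<mu> \<alpha> \<longleftrightarrow> (\<forall>n\<ge>2. nth_hom_power_associative n \<mu> \<alpha>)"

definition mult_twisted_by :: "('a \<Rightarrow> 'a) \<Rightarrow> ('a \<Rightarrow> 'a \<Rightarrow> 'a) \<Rightarrow> 'a \<Rightarrow> 'a \<Rightarrow> 'a"
  where "mult_twisted_by \<beta> \<mu> = (\<lambda>x y. \<beta> (\<mu> x y))"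

end

theory Submission
  imports Defs
begin

text \<open>
  Because \<open>\<beta>\<close> respects \<open>\<mu>\<close> and commutes with \<open>\<alpha>\<close>, every \<open>\<beta>\<close> in an expression formed in the
  twisted algebra can be moved inwards until it stands directly before an occurrence of \<open>x\<close>. If
  all occurrences collect the same number of copies, that power of \<open>\<beta>\<close> can be moved out again, and
  what remains below it is the same expression in the original algebra. The exponents of \<open>\<alpha>\<close> in
  the definitions of Hom-powers and of power associativity are such that the numbers do agree. In
  \<open>\<mu> (\<alpha>\<^bsup>n-i-1\<^esup> (x\<^bsup>i\<^esup>)) (\<alpha>\<^bsup>i-1\<^esup> (x\<^bsup>n-i\<^esup>))\<close>, for example, the left factor contributes \<open>n - i - 1\<close> from
  the twist and \<open>i - 1\<close> from the Hom-power, the right factor the same two numbers in the other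
  order, and the product itself one more, for a total of \<open>n - 1\<close> on either side. Hence both sides of
  the \<open>n\<close>th power associativity identity in the twisted algebra are the images under \<open>\<beta>\<^bsup>n-1\<^esup>\<close> of
  the corresponding sides in the original one (\<open>hom_power_twisted\<close>,
  \<open>nth_hom_power_associative_twisted\<close>), and the identity is inherited.
\<close>

lemma funpow_map_mult:
  assumes "\<And>x y. \<beta> (\<mu> x y) = \<mu> (\<beta> x) (\<beta> y)"
  shows "(\<beta> ^^ n) (\<mu> x y) = \<mu> ((\<beta> ^^ n) x) ((\<beta> ^^ n) y)"
  by (induction n) (simp_all add: assms)

lemma funpow_map_twist:
  assumes "\<And>x. \<beta> (\<alpha> x) = \<alpha> (\<beta> x)"
  shows "(\<beta> ^^ n) (\<alpha> x) = \<alpha> ((\<beta> ^^ n) x)"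
  by (induction n) (simp_all add: assms)

text \<open>The inner power of \<open>\<beta>\<close> is there because the twist of the new algebra gets applied to Hom-powers
  of the new algebra, which themselves carry a power of \<open>\<beta>\<close>.\<close>

lemma funpow_twist_comp:
  assumes "\<And>x. \<beta> (\<alpha> x) = \<alpha> (\<beta> x)"
  shows "((\<beta> \<circ> \<alpha>) ^^ m) ((\<beta> ^^ k) x) = (\<beta> ^^ (m + k)) ((\<alpha> ^^ m) x)"
proof (induction m)
  case (Suc m)
  then show ?case
    by (simp add: funpow_map_twist[of \<beta> \<alpha>, OF assms])
qed simp

lemma mult_twisted_by_apply: "mult_twisted_by \<beta> \<mu> x y = \<beta> (\<mu> x y)"
  by (simp add: mult_twisted_by_def)

lemma multiplicative_twisted:
  assumes map_mult: "\<And>x y. \<beta> (\<mu> x y) = \<mu> (\<beta> x) (\<beta> y)"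
    and map_twist: "\<And>x. \<beta> (\<alpha> x) = \<alpha> (\<beta> x)"
    and mult: "multiplicative \<mu> \<alpha>"
  shows "multiplicative (mult_twisted_by \<beta> \<mu>) (\<beta> \<circ> \<alpha>)"
  using mult by (simp add: multiplicative_def mult_twisted_by_def map_mult map_twist)

text \<open>In the recursion step both factors carry \<open>\<beta>\<^sup>m\<close>: the shorter Hom-power by induction, and
  \<open>(\<beta>\<alpha>)\<^sup>m x\<close> since \<open>\<beta>\<close> and \<open>\<alpha>\<close> commute. The product adds one more \<open>\<beta>\<close>.\<close>

lemma hom_power_twisted:
  assumes map_mult: "\<And>x y. \<beta> (\<mu> x y) = \<mu> (\<beta> x) (\<beta> y)"
    and map_twist: "\<And>x. \<beta> (\<alpha> x) = \<alpha> (\<beta> x)"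
    and "1 \<le> n"
  shows "hom_power (mult_twisted_by \<beta> \<mu>) (\<beta> \<circ> \<alpha>) x n = (\<beta> ^^ (n - 1)) (hom_power \<mu> \<alpha> x n)"
proof -
  have "hom_power (mult_twisted_by \<beta> \<mu>) (\<beta> \<circ> \<alpha>) x (Suc m) = (\<beta> ^^ m) (hom_power \<mu> \<alpha> x (Suc m))" for m
  proof (induction m)
    case (Suc m)
    have twist: "((\<beta> \<circ> \<alpha>) ^^ m) x = (\<beta> ^^ m) ((\<alpha> ^^ m) x)"
      using funpow_twist_comp[of \<beta> \<alpha> m 0 x, OF map_twist] by simp
    have "hom_power (mult_twisted_by \<beta> \<mu>) (\<beta> \<circ> \<alpha>) x (Suc (Suc m))
        = \<beta> (\<mu> ((\<beta> ^^ m) (hom_power \<mu> \<alpha> x (Suc m))) ((\<beta> ^^ m) ((\<alpha> ^^ m) x)))"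
      by (simp only: hom_power.simps Suc.IH twist mult_twisted_by_apply)
    also have "\<dots> = (\<beta> ^^ Suc m) (hom_power \<mu> \<alpha> x (Suc (Suc m)))"
      by (simp add: funpow_map_mult[of \<beta> \<mu>, OF map_mult])
    finally show ?case .
  qed simp
  from this[of "n - 1"] \<open>1 \<le> n\<close> show ?thesis
    by simp
qed

text \<open>Each factor on the right-hand side carries \<open>\<beta>\<close> to the power \<open>(n - i - 1) + (i - 1) = n - 2\<close>, and
  the twisted product supplies the missing \<open>\<beta>\<close>.\<close>

lemma nth_hom_power_associative_twisted:
  assumes map_mult: "\<And>x y. \<beta> (\<mu> x y) = \<mu> (\<beta> x) (\<beta> y)"
    and map_twist: "\<And>x. \<beta> (\<alpha> x) = \<alpha> (\<beta> x)"
    and assoc: "nth_hom_power_associative n \<mu> \<alpha>"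
  shows "nth_hom_power_associative n (mult_twisted_by \<beta> \<mu>) (\<beta> \<circ> \<alpha>)"
  unfolding nth_hom_power_associative_def
proof (intro allI ballI)
  fix x i
  assume i: "i \<in> {1..n - 1}"
  let ?p = "hom_power \<mu> \<alpha> x" and ?p' = "hom_power (mult_twisted_by \<beta> \<mu>) (\<beta> \<circ> \<alpha>) x"
  have p': "?p' j = (\<beta> ^^ (j - 1)) (?p j)" if "1 \<le> j" for j
    using hom_power_twisted[of \<beta> \<mu> \<alpha> j x] map_mult map_twist that by blast
  have left: "((\<beta> \<circ> \<alpha>) ^^ (n - i - 1)) (?p' i) = (\<beta> ^^ (n - 2)) ((\<alpha> ^^ (n - i - 1)) (?p i))"
  proof -
    have "(n - i - 1) + (i - 1) = n - 2" using i by auto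
    then show ?thesis
      using i funpow_twist_comp[of \<beta> \<alpha> "n - i - 1" "i - 1" "?p i", OF map_twist]
      by (simp add: p')
  qed
  have right: "((\<beta> \<circ> \<alpha>) ^^ (i - 1)) (?p' (n - i)) = (\<beta> ^^ (n - 2)) ((\<alpha> ^^ (i - 1)) (?p (n - i)))"
  proof -
    have "(i - 1) + (n - i - 1) = n - 2" "1 \<le> n - i" using i by auto
    then show ?thesis
      using funpow_twist_comp[of \<beta> \<alpha> "i - 1" "n - i - 1" "?p (n - i)", OF map_twist]
      by (simp add: p')
  qed
  have n: "n - 1 = Suc (n - 2)" "1 \<le> n" using i by auto
  have "?p' n = (\<beta> ^^ (n - 1)) (?p n)"
    using n(2) by (rule p')
  also have "?p n = \<mu> ((\<alpha> ^^ (n - i - 1)) (?p i)) ((\<alpha> ^^ (i - 1)) (?p (n - i)))"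
    using assoc i unfolding nth_hom_power_associative_def by blast
  also have "(\<beta> ^^ (n - 1)) \<dots> = \<beta> (\<mu> ((\<beta> ^^ (n - 2)) ((\<alpha> ^^ (n - i - 1)) (?p i)))
      ((\<beta> ^^ (n - 2)) ((\<alpha> ^^ (i - 1)) (?p (n - i)))))"
    unfolding n(1) by (simp add: funpow_map_mult[of \<beta> \<mu>, OF map_mult])
  also have "\<dots> = mult_twisted_by \<beta> \<mu> (((\<beta> \<circ> \<alpha>) ^^ (n - i - 1)) (?p' i))
      (((\<beta> \<circ> \<alpha>) ^^ (i - 1)) (?p' (n - i)))"
    by (simp only: left right mult_twisted_by_apply)
  finally show "?p' n = \<dots>" .
qed

lemma hom_algebra_twisted:
  assumes "hom_algebra s \<mu> \<alpha>" and lin: "Vector_Spaces.linear s s \<beta>"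
  shows "hom_algebra s (mult_twisted_by \<beta> \<mu>) (\<beta> \<circ> \<alpha>)"
proof -
  interpret hom_algebra s \<mu> \<alpha> by fact
  show ?thesis
  proof (intro hom_algebra.intro hom_algebra_axioms.intro vector_space_axioms)
    show "Vector_Spaces.linear s s (\<lambda>x. mult_twisted_by \<beta> \<mu> x y)" for y
      using Vector_Spaces.linear_compose[OF mult_linear_left lin] by (simp add: mult_twisted_by_def comp_def)
    show "Vector_Spaces.linear s s (\<lambda>y. mult_twisted_by \<beta> \<mu> x y)" for x
      using Vector_Spaces.linear_compose[OF mult_linear_right lin] by (simp add: mult_twisted_by_def comp_def)
    show "Vector_Spaces.linear s s (\<beta> \<circ> \<alpha>)"
      using Vector_Spaces.linear_compose[OF twist_linear lin] .
  qed
qed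

theorem theorem2p4:
  fixes s :: "'k::field_char_0 \<Rightarrow> 'a::ab_group_add \<Rightarrow> 'a"
    and \<mu> :: "'a \<Rightarrow> 'a \<Rightarrow> 'a"
    and \<alpha> \<beta> :: "'a \<Rightarrow> 'a"
  assumes "hom_algebra s \<mu> \<alpha>"
    and "hom_algebra_morphism s \<mu> \<alpha> s \<mu> \<alpha> \<beta>"
  shows "hom_algebra s (mult_twisted_by \<beta> \<mu>) (\<beta> \<circ> \<alpha>)
    \<and> (multiplicative \<mu> \<alpha> \<longrightarrow> multiplicative (mult_twisted_by \<beta> \<mu>) (\<beta> \<circ> \<alpha>))
    \<and> (\<forall>x. \<forall>n\<ge>1. hom_power (mult_twisted_by \<beta> \<mu>) (\<beta> \<circ> \<alpha>) x n
          = (\<beta> ^^ (n - 1)) (hom_power \<mu> \<alpha> x n))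
    \<and> (\<forall>n\<ge>2. nth_hom_power_associative n \<mu> \<alpha>
          \<longrightarrow> nth_hom_power_associative n (mult_twisted_by \<beta> \<mu>) (\<beta> \<circ> \<alpha>))
    \<and> (hom_power_associative \<mu> \<alpha>
          \<longrightarrow> hom_power_associative (mult_twisted_by \<beta> \<mu>) (\<beta> \<circ> \<alpha>))"
proof -
  interpret hom_algebra_morphism s \<mu> \<alpha> s \<mu> \<alpha> \<beta> by fact
  note assoc = nth_hom_power_associative_twisted[of \<beta> \<mu> \<alpha>, OF map_mult map_twist]
  show ?thesis
  proof (intro conjI allI impI)
    show "hom_algebra s (mult_twisted_by \<beta> \<mu>) (\<beta> \<circ> \<alpha>)"
      using assms(1) linear by (rule hom_algebra_twisted)
    show "multiplicative (mult_twisted_by \<beta> \<mu>) (\<beta> \<circ> \<alpha>)" if "multiplicative \<mu> \<alpha>"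
      using map_mult map_twist that by (rule multiplicative_twisted)
    show "hom_power (mult_twisted_by \<beta> \<mu>) (\<beta> \<circ> \<alpha>) x n = (\<beta> ^^ (n - 1)) (hom_power \<mu> \<alpha> x n)"
      if "1 \<le> n" for x n
      using map_mult map_twist that by (rule hom_power_twisted)
    show "nth_hom_power_associative n (mult_twisted_by \<beta> \<mu>) (\<beta> \<circ> \<alpha>)"
      if "nth_hom_power_associative n \<mu> \<alpha>" for n
      using that by (rule assoc)
    show "hom_power_associative (mult_twisted_by \<beta> \<mu>) (\<beta> \<circ> \<alpha>)" if "hom_power_associative \<mu> \<alpha>"
      using that assoc unfolding hom_power_associative_def by blast
  qed
qed

end
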